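(* Let $\mathcal{U}\subseteq\mathbb{R}^m$, let $\mathcal{W}$ be a $\sigma$-algebra on $\mathcal{U}$ and let $V:\mathcal{W}\to\mathbb{R}$ be a finite measure. Let $X\subseteq\mathbb{R}^n$ be compact and let $f,g:X\times\mathcal{U}\to\mathbb{R}$ be continuous functions. Assume that: (A1) for every $W\in\mathcal{W}$, the closure $\overline{W}$ belongs to $\mathcal{W}$; (A2) for every compact $C\subseteq\mathcal{U}$, the set $\mathcal{K}(C)\cap\mathcal{W}$ is complete with respect to the Hausdorff metric $d_H$; (A3) $\{\bar u\}\in\mathcal{W}$. Assume moreover that there is a sequence of compact sets $C_k\in\mathcal{W}$, $k\in\mathbb{N}$, such that $C_k\subseteq C_{k+1}$ for all $k\in\mathbb{N}$ and $\bigcup_{k\in\mathbb{N}}C_k=\mathcal{U}$. Then there exists a maximizer $(x^*,W^* )\in X\times\mathcal{W}$ of the inverse robust optimization problem $(\mathcal{P}_{\mathrm{IROP}})$.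
   Context: A nominal scenario $\bar u\in\mathcal{U}$ is fixed, and it is assumed that the nominal problem $f^*:=\min\{f(x,\bar u): x\in X,\ g(x,\bar u)\le 0\}$ has a feasible point and that the minimum $f^*$ is well defined (attained). A budget $\epsilon\ge 0$ is fixed. The inverse robust optimization problem $(\mathcal{P}_{\mathrm{IROP}})$ is: maximize $V(W)$ over all $(x,W)\in X\times\mathcal{W}$ subject to $f(x,u)\le f^*+\epsilon$ for all $u\in W$, $\ g(x,u)\le 0$ for all $u\in W$, and $\bar u\in W$. A maximizer is a feasible pair attaining the maximal value of $V(W)$ among feasible pairs. For compact $C\subseteq\mathcal{U}$, $\mathcal{K}(C)$ denotes the set of all compact subsets of $C$, equipped with the Hausdorff metric $d_H$ (if the empty set is included it is treated as an isolated point). Closures are taken in $\mathbb{R}^m$. *)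

theory Defs
  imports "HOL-Analysis.Analysis"
begin

section \<open>The Hausdorff metric on the compact subsets of a set\<close>

text \<open>The usual formula, for nonempty bounded sets. The value 0 for unbounded arguments is a
  totality convention: it makes the function nonnegative everywhere, as the locale
  \<open>Metric_space\<close> demands.\<close>

definition hausdorff_dist_ne :: "'a::euclidean_space set \<Rightarrow> 'a set \<Rightarrow> real" where
  "hausdorff_dist_ne A B =
     (if bounded A \<and> bounded B
      then max (SUP a\<in>A. infdist a B) (SUP b\<in>B. infdist b A) else 0)"

text \<open>The empty set is made an isolated point: its distance to any nonempty compact set is at
  least 1. The summand \<open>hausdorff_dist_ne A {0}\<close>, which is the largest norm of a point of
  \<open>A\<close>, is there so that the triangle inequality still holds
  (a constant distance to the empty set would violate it for sets that are far apart).\<close>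

definition hausdorff_dist :: "'a::euclidean_space set \<Rightarrow> 'a set \<Rightarrow> real" where
  "hausdorff_dist A B =
     (if A = {} then (if B = {} then 0 else 1 + hausdorff_dist_ne B {0})
      else if B = {} then 1 + hausdorff_dist_ne A {0}
      else hausdorff_dist_ne A B)"

definition compact_subsets :: "'a::euclidean_space set \<Rightarrow> 'a set set" where
  "compact_subsets C = {K. compact K \<and> K \<subseteq> C}"

lemma infdist_le_hausdorff_dist_ne:
  fixes A B :: "'a::euclidean_space set"
  assumes "bounded A" "bounded B" "a \<in> A"
  shows "infdist a B \<le> hausdorff_dist_ne A B"
proof -
  have "compact ((\<lambda>a. infdist a B) ` closure A)"
    by (intro compact_continuous_image continuous_intros) (simp add: assms(1))
  then have "bdd_above ((\<lambda>a. infdist a B) ` closure A)"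
    by (intro bounded_imp_bdd_above compact_imp_bounded)
  then have "bdd_above ((\<lambda>a. infdist a B) ` A)"
    by (rule bdd_above_mono) (use closure_subset in blast)
  then have "infdist a B \<le> (SUP a\<in>A. infdist a B)"
    using assms(3) by (rule cSUP_upper[rotated])
  then show ?thesis
    using assms(1,2) by (simp add: hausdorff_dist_ne_def)
qed

lemma hausdorff_dist_ne_commute: "hausdorff_dist_ne A B = hausdorff_dist_ne B A"
  by (auto simp: hausdorff_dist_ne_def max.commute)

lemma hausdorff_dist_ne_nonneg:
  assumes "A \<noteq> {}"
  shows "0 \<le> hausdorff_dist_ne A B"
proof (cases "bounded A \<and> bounded B")
  case True
  from assms obtain a where "a \<in> A" by blast
  then have "infdist a B \<le> hausdorff_dist_ne A B"
    using True by (intro infdist_le_hausdorff_dist_ne) auto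
  then show ?thesis
    using infdist_nonneg[of a B] by linarith
qed (auto simp: hausdorff_dist_ne_def)

lemma hausdorff_dist_ne_triangle:
  fixes A B C :: "'a::euclidean_space set"
  assumes "compact A" "compact B" "compact C" "A \<noteq> {}" "B \<noteq> {}" "C \<noteq> {}"
  shows "hausdorff_dist_ne A C \<le> hausdorff_dist_ne A B + hausdorff_dist_ne B C"
proof -
  have *: "infdist a C \<le> hausdorff_dist_ne A B + hausdorff_dist_ne B C"
    if "compact A" "compact B" "compact C" "B \<noteq> {}" "a \<in> A" for a and A B C :: "'a set"
  proof -
    obtain b where b: "b \<in> B" "infdist a B = dist a b"
      using infdist_attains_inf[OF compact_imp_closed[OF \<open>compact B\<close>] \<open>B \<noteq> {}\<close>] by blast
    have "infdist a C \<le> infdist b C + dist a b"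
      by (rule infdist_triangle)
    moreover have "infdist a B \<le> hausdorff_dist_ne A B" "infdist b C \<le> hausdorff_dist_ne B C"
      using that b(1) by (auto intro!: infdist_le_hausdorff_dist_ne compact_imp_bounded)
    ultimately show ?thesis
      using b(2) by linarith
  qed
  have "(SUP a\<in>A. infdist a C) \<le> hausdorff_dist_ne A B + hausdorff_dist_ne B C"
    using assms by (intro cSUP_least *)
  moreover have "(SUP c\<in>C. infdist c A) \<le> hausdorff_dist_ne C B + hausdorff_dist_ne B A"
    using assms by (intro cSUP_least *)
  ultimately show ?thesis
    using assms(1,3)[THEN compact_imp_bounded]
      hausdorff_dist_ne_commute[of C B] hausdorff_dist_ne_commute[of B A]
    unfolding hausdorff_dist_ne_def[of A C] by simp
qed

lemma hausdorff_dist_ne_zero_imp_subset: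
  fixes A B :: "'a::euclidean_space set"
  assumes "compact A" "compact B" "B \<noteq> {}" "hausdorff_dist_ne A B = 0"
  shows "A \<subseteq> B"
proof
  fix a assume "a \<in> A"
  then have "infdist a B \<le> 0"
    using infdist_le_hausdorff_dist_ne[of A B a] assms compact_imp_bounded by metis
  then have "infdist a B = 0"
    using infdist_nonneg[of a B] by linarith
  then show "a \<in> B"
    using in_closed_iff_infdist_zero[OF compact_imp_closed[OF assms(2)] assms(3)] by blast
qed

lemma Metric_space_hausdorff_dist:
  fixes C :: "'a::euclidean_space set"
  shows "Metric_space (compact_subsets C) hausdorff_dist"
proof
  fix A B :: "'a set"
  show "hausdorff_dist A B = hausdorff_dist B A"
    by (simp add: hausdorff_dist_def hausdorff_dist_ne_commute)
  show "0 \<le> hausdorff_dist A B"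
    by (simp add: hausdorff_dist_def hausdorff_dist_ne_nonneg)
next
  fix A B :: "'a set"
  assume "A \<in> compact_subsets C" "B \<in> compact_subsets C"
  then have cpt: "compact A" "compact B"
    by (auto simp: compact_subsets_def)
  show "hausdorff_dist A B = 0 \<longleftrightarrow> A = B"
  proof (cases "A = {} \<or> B = {}")
    case True
    then show ?thesis
      using hausdorff_dist_ne_nonneg[of A "{0}"] hausdorff_dist_ne_nonneg[of B "{0}"]
      by (cases "A = {}"; cases "B = {}") (simp_all add: hausdorff_dist_def)
  next
    case False
    have "hausdorff_dist_ne A A = 0"
      using False by (simp add: hausdorff_dist_ne_def)
    moreover have "A = B" if "hausdorff_dist_ne A B = 0"
      using False cpt that hausdorff_dist_ne_commute[of A B]
      by (intro subset_antisym hausdorff_dist_ne_zero_imp_subset) auto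
    ultimately show ?thesis
      using False by (auto simp: hausdorff_dist_def)
  qed
next
  fix A B D :: "'a set"
  assume "A \<in> compact_subsets C" "B \<in> compact_subsets C" "D \<in> compact_subsets C"
  then have cpt: "compact A" "compact B" "compact D"
    by (auto simp: compact_subsets_def)
  note comm = hausdorff_dist_ne_commute
  note tri = hausdorff_dist_ne_triangle
  show "hausdorff_dist A D \<le> hausdorff_dist A B + hausdorff_dist B D"
  proof (cases "A = {}"; cases "B = {}"; cases "D = {}")
    assume "A = {}" "B \<noteq> {}" "D \<noteq> {}"
    then show ?thesis
      using tri[of D B "{0}"] cpt by (simp add: hausdorff_dist_def comm[of D B])
  next
    assume "A \<noteq> {}" "B = {}" "D \<noteq> {}"
    then show ?thesis
      using tri[of A "{0}" D] cpt by (simp add: hausdorff_dist_def comm[of "{0}" D])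
  next
    assume "A \<noteq> {}" "B \<noteq> {}" "D = {}"
    then show ?thesis
      using tri[of A B "{0}"] cpt by (simp add: hausdorff_dist_def)
  next
    assume "A \<noteq> {}" "B \<noteq> {}" "D \<noteq> {}"
    then show ?thesis
      using tri[of A B D] cpt by (simp add: hausdorff_dist_def)
  qed (auto simp: hausdorff_dist_def intro!: add_nonneg_nonneg hausdorff_dist_ne_nonneg)
qed

section \<open>Inverse robust optimization\<close>

text \<open>The value \<open>f\<^sup>*\<close> of the nominal problem; it is the minimum whenever that is attained.\<close>

definition nominal_value ::
  "'x set \<Rightarrow> ('x \<times> 'u \<Rightarrow> real) \<Rightarrow> ('x \<times> 'u \<Rightarrow> real) \<Rightarrow> 'u \<Rightarrow> real" where
  "nominal_value X f g ubar = (LEAST v. \<exists>x\<in>X. g (x, ubar) \<le> 0 \<and> v = f (x, ubar))"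

text \<open>The measure space \<open>M\<close> stands for the triple \<open>(\<U>, \<W>, V)\<close>, i.e.
  \<open>\<U> = space M\<close>, \<open>\<W> = sets M\<close> and \<open>V(W) = measure M W\<close>.\<close>

definition irop_feasible ::
  "'u measure \<Rightarrow> 'x set \<Rightarrow> ('x \<times> 'u \<Rightarrow> real) \<Rightarrow> ('x \<times> 'u \<Rightarrow> real) \<Rightarrow> 'u \<Rightarrow> real
    \<Rightarrow> 'x \<times> 'u set \<Rightarrow> bool" where
  "irop_feasible M X f g ubar \<epsilon> = (\<lambda>(x, W).
     x \<in> X \<and> W \<in> sets M \<and>
     (\<forall>u\<in>W. f (x, u) \<le> nominal_value X f g ubar + \<epsilon>) \<and>
     (\<forall>u\<in>W. g (x, u) \<le> 0) \<and>
     ubar \<in> W)"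

definition irop_maximizer ::
  "'u measure \<Rightarrow> 'x set \<Rightarrow> ('x \<times> 'u \<Rightarrow> real) \<Rightarrow> ('x \<times> 'u \<Rightarrow> real) \<Rightarrow> 'u \<Rightarrow> real
    \<Rightarrow> 'x \<times> 'u set \<Rightarrow> bool" where
  "irop_maximizer M X f g ubar \<epsilon> =
     is_arg_max (\<lambda>(x, W). measure M W) (irop_feasible M X f g ubar \<epsilon>)"

end

theory Submission
  imports Defs
begin

text \<open>Along a maximizing sequence of feasible pairs \<open>(x\<^sub>j, W\<^sub>j)\<close> with
  \<open>x\<^sub>j \<longlonglongrightarrow> x\<close>, take the outer limit
  \<open>W = (\<Inter>N. closure (\<Union>j\<ge>N. W\<^sub>j))\<close>. It is measurable by (A1), continuity of the
  measure from above gives \<open>V(W) \<ge> lim V(W\<^sub>j)\<close>, and \<open>(x, W)\<close> is feasible because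
  every point of \<open>W\<close> is the limit of points of \<open>W\<^sub>j\<close> along indices tending to
  infinity.\<close>

definition outer_limit :: "(nat \<Rightarrow> 'a::topological_space set) \<Rightarrow> 'a set" where
  "outer_limit W = (\<Inter>N. closure (\<Union>j\<in>{N..}. W j))"

lemma in_outer_limit:
  assumes "\<And>j. u \<in> W j"
  shows "u \<in> outer_limit W"
  unfolding outer_limit_def
proof (rule INT_I)
  fix N
  have "u \<in> (\<Union>j\<in>{N..}. W j)"
    using assms by auto
  then show "u \<in> closure (\<Union>j\<in>{N..}. W j)"
    by (rule subsetD[OF closure_subset])
qed

text \<open>Diagonal choice: the \<open>k\<close>-th point is taken from the \<open>k\<close>-th
  tail. The index sequence \<open>r\<close> need not be monotone; \<open>r k \<ge> k\<close> makes
  it tend to infinity, which is enough to compose it with a convergent sequence.\<close>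

lemma outer_limit_approx:
  fixes W :: "nat \<Rightarrow> 'a::metric_space set"
  assumes "u \<in> outer_limit W"
  obtains r w where "filterlim r at_top sequentially" "\<And>k. w k \<in> W (r k)" "w \<longlonglongrightarrow> u"
proof -
  have "\<exists>j w. j \<ge> k \<and> w \<in> W j \<and> dist w u < 1 / real (Suc k)" for k
  proof -
    have "u \<in> closure (\<Union>j\<in>{k..}. W j)"
      using assms by (auto simp: outer_limit_def)
    then have "\<exists>w\<in>(\<Union>j\<in>{k..}. W j). dist w u < 1 / real (Suc k)"
      by (simp only: closure_approachable) simp
    then show ?thesis
      by auto
  qed
  then obtain r w where r: "\<And>k. r k \<ge> k" and w: "\<And>k. w k \<in> W (r k)"
    and d: "\<And>k. dist (w k) u < 1 / real (Suc k)"
    by metis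
  have "filterlim r at_top sequentially"
    using r by (intro filterlim_at_top_mono[OF filterlim_ident]) auto
  moreover have "w \<longlonglongrightarrow> u"
  proof (rule tendsto_dist_iff[THEN iffD2])
    show "(\<lambda>k. dist (w k) u) \<longlonglongrightarrow> 0"
      by (rule tendsto_sandwich[OF _ _ tendsto_const LIMSEQ_Suc[OF lim_1_over_n]])
        (use d in \<open>auto intro!: always_eventually less_imp_le simp del: of_nat_Suc\<close>)
  qed
  ultimately show ?thesis
    using w that by blast
qed

text \<open>A nonstrict inequality survives the limit by joint continuity of \<open>h\<close>, since
  points and sets are followed along the same indices \<open>r k\<close>. Membership of
  \<open>u\<close> in \<open>U\<close> is a separate premise: closures are taken in the whole type
  and could leave the domain where \<open>h\<close> is continuous.\<close>

lemma outer_limit_bound: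
  fixes h :: "'a::metric_space \<times> 'b::metric_space \<Rightarrow> real"
  assumes h: "continuous_on (X \<times> U) h"
    and x: "\<And>j. x j \<in> X" "x \<longlonglongrightarrow> a" "a \<in> X"
    and W: "\<And>j. W j \<subseteq> U"
    and le: "\<And>j w. w \<in> W j \<Longrightarrow> h (x j, w) \<le> c"
    and u: "u \<in> outer_limit W" "u \<in> U"
  shows "h (a, u) \<le> c"
proof -
  obtain r w where r: "filterlim r at_top sequentially"
    and w: "\<And>k. w k \<in> W (r k)" "w \<longlonglongrightarrow> u"
    using outer_limit_approx[OF u(1)] by blast
  have "(\<lambda>k. x (r k)) \<longlonglongrightarrow> a"
    using filterlim_compose[OF x(2) r] .
  then have "(\<lambda>k. (x (r k), w k)) \<longlonglongrightarrow> (a, u)"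
    using w(2) by (rule tendsto_Pair)
  then have "(\<lambda>k. h (x (r k), w k)) \<longlonglongrightarrow> h (a, u)"
  proof (rule continuous_on_tendsto_compose[OF h])
    show "\<forall>\<^sub>F k in sequentially. (x (r k), w k) \<in> X \<times> U"
      using x(1) W w(1) by (intro always_eventually) blast
  qed (use x(3) u(2) in simp)
  then show ?thesis
    by (rule LIMSEQ_le_const2) (use le w(1) in blast)
qed

context
  fixes M :: "'a::topological_space measure" and W :: "nat \<Rightarrow> 'a set"
  assumes closure_sets: "\<And>A. A \<in> sets M \<Longrightarrow> closure A \<in> sets M"
    and W_sets: "\<And>j. W j \<in> sets M"
begin

lemma outer_limit_tail_sets: "closure (\<Union>j\<in>{N..}. W j) \<in> sets M"
  using W_sets by (intro closure_sets sets.countable_UN') auto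

lemma sets_outer_limit: "outer_limit W \<in> sets M"
  unfolding outer_limit_def using outer_limit_tail_sets by (intro sets.countable_INT) auto

text \<open>The closed tails \<open>?E N\<close> decrease to the outer limit, so finiteness of the
  measure gives continuity from above. Each \<open>?E N\<close> contains \<open>W N\<close>, and
  comparing the two limits gives the bound.\<close>

lemma measure_outer_limit_ge:
  assumes "finite_measure M" and lim: "(\<lambda>j. measure M (W j)) \<longlonglongrightarrow> v"
  shows "v \<le> measure M (outer_limit W)"
proof -
  interpret finite_measure M by fact
  let ?E = "\<lambda>N. closure (\<Union>j\<in>{N..}. W j)"
  have "(\<lambda>N. measure M (?E N)) \<longlonglongrightarrow> measure M (\<Inter>N. ?E N)"
  proof (rule finite_Lim_measure_decseq)
    show "decseq ?E"
      unfolding decseq_def by (intro allI impI closure_mono UN_mono) auto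
  qed (use outer_limit_tail_sets in blast)
  moreover have "measure M (W N) \<le> measure M (?E N)" for N
  proof (rule finite_measure_mono[OF _ outer_limit_tail_sets])
    have "W N \<subseteq> (\<Union>j\<in>{N..}. W j)"
      by auto
    then show "W N \<subseteq> ?E N"
      using closure_subset by (rule order_trans)
  qed
  ultimately show ?thesis
    unfolding outer_limit_def using lim by (intro LIMSEQ_le) auto
qed

end

lemma nominal_value_eq:
  assumes "is_arg_min (\<lambda>x. f (x, ubar)) (\<lambda>x. x \<in> X \<and> g (x, ubar) \<le> 0) x"
  shows "nominal_value X f g ubar = f (x, ubar)"
  unfolding nominal_value_def
  by (rule Least_equality) (use assms in \<open>auto simp: is_arg_min_linorder\<close>)

lemma irop_feasible_outer_limit:
  fixes f g :: "'x::metric_space \<times> 'u::metric_space \<Rightarrow> real"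
  assumes f: "continuous_on (X \<times> space M) f" and g: "continuous_on (X \<times> space M) g"
    and A1: "\<And>W. W \<in> sets M \<Longrightarrow> closure W \<in> sets M"
    and feas: "\<And>j. irop_feasible M X f g ubar \<epsilon> (x j, W j)"
    and lim: "x \<longlonglongrightarrow> a" "a \<in> X"
  shows "irop_feasible M X f g ubar \<epsilon> (a, outer_limit W)"
proof -
  have x: "x j \<in> X" and W: "W j \<in> sets M" and ubar: "ubar \<in> W j"
    and bf: "\<And>w. w \<in> W j \<Longrightarrow> f (x j, w) \<le> nominal_value X f g ubar + \<epsilon>"
    and bg: "\<And>w. w \<in> W j \<Longrightarrow> g (x j, w) \<le> 0" for j
    using feas[of j] by (auto simp: irop_feasible_def)
  note subs = sets.sets_into_space[OF W]
  have L: "outer_limit W \<in> sets M"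
    using A1 W by (rule sets_outer_limit)
  have "f (a, u) \<le> nominal_value X f g ubar + \<epsilon> \<and> g (a, u) \<le> 0"
    if u: "u \<in> outer_limit W" for u
  proof -
    \<comment> \<open>The closure assumption does more than give measurability: it puts the outer
      limit into \<open>sets M\<close>, hence inside the domain of \<open>f\<close> and
      \<open>g\<close>.\<close>
    have "u \<in> space M"
      using sets.sets_into_space[OF L] u by blast
    then show ?thesis
      using outer_limit_bound[OF f x lim subs bf u] outer_limit_bound[OF g x lim subs bg u]
      by blast
  qed
  then show ?thesis
    using L lim(2) in_outer_limit[of ubar W] ubar by (auto simp: irop_feasible_def)
qed

lemma irop_maximizer_exists:
  fixes f g :: "'x::metric_space \<times> 'u::metric_space \<Rightarrow> real"
  assumes M: "finite_measure M" and X: "compact X"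
    and f: "continuous_on (X \<times> space M) f" and g: "continuous_on (X \<times> space M) g"
    and A1: "\<And>W. W \<in> sets M \<Longrightarrow> closure W \<in> sets M"
    and ne: "irop_feasible M X f g ubar \<epsilon> p"
  shows "\<exists>x W. irop_maximizer M X f g ubar \<epsilon> (x, W)"
proof -
  interpret finite_measure M by fact
  define S where "S = {measure M W |x W. irop_feasible M X f g ubar \<epsilon> (x, W)}"
  have "S \<noteq> {}"
    using ne by (cases p) (auto simp: S_def)
  have bdd: "bdd_above S"
    by (rule bdd_aboveI[of _ "measure M (space M)"]) (auto simp: S_def bounded_measure)
  \<comment> \<open>A nonempty set of reals bounded above has its supremum in its closure, which
    yields a maximizing sequence of values.\<close>
  have "Sup S \<in> closure S"
    using \<open>S \<noteq> {}\<close> bdd by (rule closure_contains_Sup)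
  then obtain s where s: "\<And>j. s j \<in> S" "s \<longlonglongrightarrow> Sup S"
    unfolding closure_sequential by blast
  have "\<exists>x W. irop_feasible M X f g ubar \<epsilon> (x, W) \<and> s j = measure M W" for j
    using s(1)[of j] by (auto simp: S_def)
  then obtain x W where feas: "\<And>j. irop_feasible M X f g ubar \<epsilon> (x j, W j)"
    and sW: "\<And>j. s j = measure M (W j)"
    by metis
  have "\<forall>j. x j \<in> X"
    using feas by (auto simp: irop_feasible_def)
  \<comment> \<open>Compactness is applied to the decisions only. The sets are merely reindexed by
    the same \<open>r\<close>, which preserves feasibility and the limit \<open>Sup S\<close> of the
    measures.\<close>
  then obtain a r where a: "a \<in> X" and r: "strict_mono r" and lim: "(x \<circ> r) \<longlonglongrightarrow> a"
    using X unfolding compact_def by blast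
  have feas': "irop_feasible M X f g ubar \<epsilon> ((x \<circ> r) j, (W \<circ> r) j)" for j
    using feas by simp
  have sets: "(W \<circ> r) j \<in> sets M" for j
    using feas' by (simp add: irop_feasible_def)
  have "(\<lambda>j. measure M ((W \<circ> r) j)) \<longlonglongrightarrow> Sup S"
    using LIMSEQ_subseq_LIMSEQ[OF s(2) r] by (simp add: sW comp_def)
  with A1 sets M have ge: "Sup S \<le> measure M (outer_limit (W \<circ> r))"
    by (rule measure_outer_limit_ge)
  have "measure M W' \<le> measure M (outer_limit (W \<circ> r))"
    if "irop_feasible M X f g ubar \<epsilon> (x', W')" for x' W'
  proof -
    have "measure M W' \<in> S"
      using that by (auto simp: S_def)
    then show ?thesis
      using cSup_upper[OF _ bdd] ge by fastforce
  qed
  then have "irop_maximizer M X f g ubar \<epsilon> (a, outer_limit (W \<circ> r))"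
    using irop_feasible_outer_limit[OF f g A1 feas' lim a]
    by (auto simp: irop_maximizer_def is_arg_max_linorder comp_def)
  then show ?thesis
    by blast
qed

theorem theorem2p4:
  fixes U :: "(real ^ 'm) set" and M :: "(real ^ 'm) measure"
    and X :: "(real ^ 'n) set"
    and f g :: "(real ^ 'n) \<times> (real ^ 'm) \<Rightarrow> real"
    and ubar :: "real ^ 'm" and \<epsilon> :: real
    and C :: "nat \<Rightarrow> (real ^ 'm) set"
  assumes space_M: "space M = U"
    and finite_M: "finite_measure M"
    and X: "compact X"
    and f: "continuous_on (X \<times> U) f"
    and g: "continuous_on (X \<times> U) g"
    and ubar: "ubar \<in> U"
    and nominal_feasible: "\<exists>x\<in>X. g (x, ubar) \<le> 0"
    and nominal_attained: "\<exists>x. is_arg_min (\<lambda>x. f (x, ubar)) (\<lambda>x. x \<in> X \<and> g (x, ubar) \<le> 0) x"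
    and eps: "\<epsilon> \<ge> 0"
    and A1: "\<forall>W \<in> sets M. closure W \<in> sets M"
    and A2: "\<forall>K. compact K \<and> K \<subseteq> U \<longrightarrow>
               Metric_space.mcomplete (compact_subsets K \<inter> sets M) hausdorff_dist"
    and A3: "{ubar} \<in> sets M"
    and C_compact: "\<And>k. compact (C k)"
    and C_sets: "\<And>k. C k \<in> sets M"
    and C_mono: "\<And>k. C k \<subseteq> C (Suc k)"
    and C_Union: "(\<Union>k. C k) = U"
  shows "\<exists>x W. irop_maximizer M X f g ubar \<epsilon> (x, W)"
proof -
  obtain x where x: "is_arg_min (\<lambda>x. f (x, ubar)) (\<lambda>x. x \<in> X \<and> g (x, ubar) \<le> 0) x"
    using nominal_attained by blast
  \<comment> \<open>A nominal minimizer paired with the singleton scenario set starts the argument: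
    its objective equals the nominal value, and the budget is nonnegative. This makes the set of
    attainable measures nonempty.\<close>
  then have "irop_feasible M X f g ubar \<epsilon> (x, {ubar})"
    using A3 eps nominal_value_eq[OF x] by (auto simp: irop_feasible_def is_arg_min_def)
  then show ?thesis
    using irop_maximizer_exists[OF finite_M X] f g A1 unfolding space_M by blast
qed

end
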